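(* Let $A_0,\dots,A_n\in\mathcal S^p$ be such that the system $\mathcal A(\mathbf x)\in\mathcal{COP}^p$ is consistent. The following statements are equivalent: j) $\mathbf b(k,j)\in\mathrm{cone}\{\mathbf a(\mathbf t):\mathbf t\in T_{im}\}$ for all $k\in M(j)$ and all $j\in J$; jj) the cones $\mathrm{cone}\{\mathbf b(k,j):k\in M(j),\ j\in J\}$ and $\mathrm{cone}\{\mathbf a(\mathbf t):\mathbf t\in T_{im}\}$ coincide; jjj) $\mathrm{span}\{\mathbf b(k,j):k\in M(j),\ j\in J\}=\mathrm{cone}\{\mathbf a(\mathbf t):\mathbf t\in T_{im}\}$.
   Context: Fix integers $p>1$, $n\ge 1$. $\mathcal S^p$ is the space of real symmetric $p\times p$ matrices; $\mathbf e_1,\dots,\mathbf e_p$ is the standard basis of $\mathbb R^p$; $\mathbb R^p_+$ is the set of vectors with non-negative components; $P=\{1,\dots,p\}$; $T=\{\mathbf t\in\mathbb R^p_+:\sum_{k\in P} t_k=1\}$; $\mathcal{COP}^p=\{D\in\mathcal S^p:\mathbf t^\top D\mathbf t\ge 0\ \forall \mathbf t\in\mathbb R^p_+\}$. For a set $\mathcal B$, $\mathrm{cone}\,\mathcal B$ is the set of all finite linear combinations of elements of $\mathcal B$ with non-negative coefficients (so $\mathrm{cone}\,\emptyset=\{0\}$). Given $A_0,\dots,A_n\in\mathcal S^p$, put $\mathcal A(\mathbf x)=A_0+\sum_{m=1}^n x_mA_m$ for $\mathbf x\in\mathbb R^n$ and $X=\{\mathbf x\in\mathbb R^n:\mathcal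 A(\mathbf x)\in\mathcal{COP}^p\}$. The system is consistent if $X\ne\emptyset$. $T_{im}=\{\mathbf t\in T:\mathbf t^\top\mathcal A(\mathbf x)\mathbf t=0\ \forall\mathbf x\in X\}$ is the set of normalized immobile indices; it is empty or a finite union of convex bounded polyhedra. $\{\boldsymbol\tau(j):j\in J\}$, $|J|<\infty$, is the set of vertices of $\mathrm{conv}\,T_{im}$ ($J=\emptyset$ if $T_{im}=\emptyset$). For $j\in J$: $M(j)=\{k\in P:\mathbf e_k^\top\mathcal A(\mathbf x)\boldsymbol\tau(j)=0\ \forall\mathbf x\in X\}$. Vectors in $\mathbb R^{n+1}$: $\mathbf a(\mathbf t)=(\mathbf t^\top A_m\mathbf t)_{m=0,\dots,n}$ for $\mathbf t\in T$, and $\mathbf b(k,j)=(\mathbf e_k^\top A_m\boldsymbol\tau(j))_{m=0,\dots,n}$ for $k\in P$, $j\in J$. *)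

theory Defs
  imports "HOL-Analysis.Analysis"
begin

definition symmetric_matrix :: "real^'p^'p \<Rightarrow> bool" where
  "symmetric_matrix D \<longleftrightarrow> transpose D = D"

definition nonneg_orthant :: "(real^'p) set" where
  "nonneg_orthant = {t. \<forall>k. 0 \<le> t $ k}"

definition std_simplex :: "(real^'p) set" where
  "std_simplex = {t \<in> nonneg_orthant. (\<Sum>k\<in>UNIV. t $ k) = 1}"

definition copositive :: "(real^'p^'p) set" where
  "copositive = {D. symmetric_matrix D \<and> (\<forall>t\<in>nonneg_orthant. 0 \<le> t \<bullet> (D *v t))}"

(* Unlike "cone hull" and "conic hull", which only close under scaling, this is the
   generated convex cone; the empty sum is allowed, so the empty set generates {0}. *)
definition fin_cone :: "'a::real_vector set \<Rightarrow> 'a set" where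
  "fin_cone B = {\<Sum>v\<in>S. c v *\<^sub>R v | S c. finite S \<and> S \<subseteq> B \<and> (\<forall>v\<in>S. 0 \<le> (c v :: real))}"

lemma fin_cone_empty: "fin_cone {} = {0}"
  by (auto simp: fin_cone_def)

lemma fin_cone_eq_convex_cone_hull: "fin_cone B = convex_cone hull B"
proof
  show "fin_cone B \<subseteq> convex_cone hull B"
  proof
    fix x assume "x \<in> fin_cone B"
    then obtain S c where S: "finite S" "S \<subseteq> B" "\<forall>v\<in>S. 0 \<le> (c v :: real)"
      and x: "x = (\<Sum>v\<in>S. c v *\<^sub>R v)"
      by (auto simp: fin_cone_def)
    from S have "(\<Sum>v\<in>S. c v *\<^sub>R v) \<in> convex_cone hull B"
      by (induction S rule: finite_induct)
        (auto simp: convex_cone_hull_contains_0 intro!: convex_cone_hull_add convex_cone_hull_mul intro: hull_inc)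
    with x show "x \<in> convex_cone hull B" by simp
  qed
next
  have add: "x + y \<in> fin_cone B" if "x \<in> fin_cone B" "y \<in> fin_cone B" for x y
  proof -
    from that obtain S c S' c' where
      S: "finite S" "S \<subseteq> B" "\<forall>v\<in>S. 0 \<le> (c v :: real)" "x = (\<Sum>v\<in>S. c v *\<^sub>R v)" and
      S': "finite S'" "S' \<subseteq> B" "\<forall>v\<in>S'. 0 \<le> (c' v :: real)" "y = (\<Sum>v\<in>S'. c' v *\<^sub>R v)"
      unfolding fin_cone_def by blast
    define d where "d v = (if v \<in> S then c v else 0) + (if v \<in> S' then c' v else 0)" for v
    have "x = (\<Sum>v\<in>S \<union> S'. (if v \<in> S then c v else 0) *\<^sub>R v)"
      unfolding S(4) using S S' by (intro sum.mono_neutral_cong_left) auto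
    moreover have "y = (\<Sum>v\<in>S \<union> S'. (if v \<in> S' then c' v else 0) *\<^sub>R v)"
      unfolding S'(4) using S S' by (intro sum.mono_neutral_cong_left) auto
    ultimately have "x + y = (\<Sum>v\<in>S \<union> S'. d v *\<^sub>R v)"
      by (simp add: d_def scaleR_add_left sum.distrib)
    moreover have "finite (S \<union> S')" "S \<union> S' \<subseteq> B" "\<forall>v\<in>S \<union> S'. 0 \<le> d v"
      using S S' by (auto simp: d_def)
    ultimately show ?thesis unfolding fin_cone_def by blast
  qed
  have mul: "r *\<^sub>R x \<in> fin_cone B" if "x \<in> fin_cone B" "0 \<le> r" for x r
  proof -
    from that obtain S c where S: "finite S" "S \<subseteq> B" "\<forall>v\<in>S. 0 \<le> (c v :: real)"
      "x = (\<Sum>v\<in>S. c v *\<^sub>R v)"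
      unfolding fin_cone_def by blast
    have "r *\<^sub>R x = (\<Sum>v\<in>S. (r * c v) *\<^sub>R v)" by (simp add: S(4) scaleR_right.sum)
    moreover have "\<forall>v\<in>S. 0 \<le> r * c v" using S that by simp
    ultimately show ?thesis unfolding fin_cone_def
      using S(1,2) by (intro CollectI exI[of _ S] exI[of _ "\<lambda>v. r * c v"]) simp
  qed
  have zero: "0 \<in> fin_cone B"
    unfolding fin_cone_def by (intro CollectI exI[of _ "{}"]) simp
  have "convex_cone (fin_cone B)"
    using zero add mul unfolding convex_cone_iff by auto
  moreover have "B \<subseteq> fin_cone B"
  proof
    fix v assume "v \<in> B"
    then show "v \<in> fin_cone B"
      unfolding fin_cone_def by (intro CollectI exI[of _ "{v}"] exI[of _ "\<lambda>_. 1"]) simp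
  qed
  ultimately show "convex_cone hull B \<subseteq> fin_cone B"
    by (simp add: hull_minimal)
qed

(* The data are the constant term A0 and the family A indexed by the finite type 'n. *)
definition mat_fun :: "real^'p^'p \<Rightarrow> ('n::finite \<Rightarrow> real^'p^'p) \<Rightarrow> real^'n \<Rightarrow> real^'p^'p" where
  "mat_fun A0 A x = A0 + (\<Sum>m\<in>UNIV. x $ m *\<^sub>R A m)"

definition feasible :: "real^'p^'p \<Rightarrow> ('n::finite \<Rightarrow> real^'p^'p) \<Rightarrow> (real^'n) set" where
  "feasible A0 A = {x. mat_fun A0 A x \<in> copositive}"

definition immobile :: "real^'p^'p \<Rightarrow> ('n::finite \<Rightarrow> real^'p^'p) \<Rightarrow> (real^'p) set" where
  "immobile A0 A = {t \<in> std_simplex. \<forall>x\<in>feasible A0 A. t \<bullet> (mat_fun A0 A x *v t) = 0}"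

(* The vertices tau(j) are not enumerated: the vertex itself plays the role of the index j. *)
definition immobile_vertices :: "real^'p^'p \<Rightarrow> ('n::finite \<Rightarrow> real^'p^'p) \<Rightarrow> (real^'p) set" where
  "immobile_vertices A0 A = {\<tau>. \<tau> extreme_point_of (convex hull (immobile A0 A))}"

definition zero_indices :: "real^'p^'p \<Rightarrow> ('n::finite \<Rightarrow> real^'p^'p) \<Rightarrow> real^'p \<Rightarrow> 'p set" where
  "zero_indices A0 A \<tau> = {k. \<forall>x\<in>feasible A0 A. axis k 1 \<bullet> (mat_fun A0 A x *v \<tau>) = 0}"

(* The space R^(n+1) is represented as R x R^n; the first component belongs to A0. *)
definition a_vec :: "real^'p^'p \<Rightarrow> ('n::finite \<Rightarrow> real^'p^'p) \<Rightarrow> real^'p \<Rightarrow> real \<times> (real^'n)" where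
  "a_vec A0 A t = (t \<bullet> (A0 *v t), \<chi> m. t \<bullet> (A m *v t))"

definition b_vec :: "real^'p^'p \<Rightarrow> ('n::finite \<Rightarrow> real^'p^'p) \<Rightarrow> 'p \<Rightarrow> real^'p \<Rightarrow> real \<times> (real^'n)" where
  "b_vec A0 A k \<tau> = (axis k 1 \<bullet> (A0 *v \<tau>), \<chi> m. axis k 1 \<bullet> (A m *v \<tau>))"

definition a_set :: "real^'p^'p \<Rightarrow> ('n::finite \<Rightarrow> real^'p^'p) \<Rightarrow> (real \<times> (real^'n)) set" where
  "a_set A0 A = {a_vec A0 A t | t. t \<in> immobile A0 A}"

definition b_set :: "real^'p^'p \<Rightarrow> ('n::finite \<Rightarrow> real^'p^'p) \<Rightarrow> (real \<times> (real^'n)) set" where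
  "b_set A0 A = {b_vec A0 A k \<tau> | k \<tau>. \<tau> \<in> immobile_vertices A0 A \<and> k \<in> zero_indices A0 A \<tau>}"

end

theory Submission
  imports Defs
begin

text \<open>
Write \<open>K\<^sub>a\<close> and \<open>K\<^sub>b\<close> for the cones generated by \<open>a_set A0 A\<close> and \<open>b_set A0 A\<close>. The first
condition says that \<open>K\<^sub>b \<subseteq> K\<^sub>a\<close>, and \<open>K\<^sub>b\<close> always lies in the span of \<open>b_set A0 A\<close>. Hence the
theorem follows from two facts: \<open>K\<^sub>a \<subseteq> K\<^sub>b\<close> holds unconditionally, and \<open>K\<^sub>a = K\<^sub>b\<close> forces this cone
to be a subspace.

The inclusion (\<open>fin_cone_a_set_subset\<close>): an immobile index \<open>t\<close> minimises the form of every feasible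
matrix over the orthant, so the gradient of the form at \<open>t\<close> is non-negative and vanishes on the
support of \<open>t\<close>. Thus the support consists of zero indices of \<open>t\<close>, and \<open>a_vec A0 A t\<close>, which is the
sum of the vectors \<open>b_vec A0 A k t\<close> with weights \<open>t $ k\<close>, involves zero indices only. These vectors
\<open>b_vec A0 A k t\<close> lie in \<open>K\<^sub>b\<close> even if \<open>t\<close> is not a vertex (\<open>b_vec_in_fin_cone_b_set\<close>), because \<open>t\<close> is a
convex combination of vertices by the theorem of Krein and Milman.

The subspace property (\<open>span_b_set_eq_fin_cone\<close>): suppose that \<open>y\<close> is non-negative on \<open>K\<^sub>b\<close>, and let
\<open>x0\<close> be a relative interior point of the feasible set. The matrix belonging to \<open>y\<close> is then a feasible
direction of the copositive cone at \<open>mat_fun A0 A x0\<close>: at every zero of the form in the simplex, the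
gradient entries that vanish do not become negative. That this first-order condition suffices is
\<open>eventually_copositive_in_direction\<close>, proved by induction over the faces of the orthant. So one can
move from \<open>x0\<close> a little in the direction \<open>y\<close> and stay feasible. The form at an immobile index is \<open>0\<close>
before and after this move, hence \<open>y\<close> vanishes on \<open>a_set A0 A\<close>. If \<open>K\<^sub>a = K\<^sub>b\<close>, this shows that no
hyperplane through \<open>0\<close> supports the cone without containing it, and a convex cone with this property
is a subspace (\<open>convex_cone_eq_span\<close>).
\<close>

section \<open>Quadratic forms of symmetric and copositive matrices\<close>

lemma inner_matrix_vector_commute:
  fixes D :: "real^'p^'p"
  assumes "symmetric_matrix D"
  shows "x \<bullet> (D *v y) = y \<bullet> (D *v x)"
proof -
  have "x \<bullet> (D *v y) = (transpose D *v x) \<bullet> y"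
    by (simp add: dot_lmul_matrix)
  with assms show ?thesis
    by (simp add: symmetric_matrix_def inner_commute)
qed

lemma quadratic_form_add_scaleR:
  fixes D :: "real^'p^'p"
  assumes "symmetric_matrix D"
  shows "(t + s *\<^sub>R z) \<bullet> (D *v (t + s *\<^sub>R z))
           = t \<bullet> (D *v t) + 2 * s * (t \<bullet> (D *v z)) + s\<^sup>2 * (z \<bullet> (D *v z))"
  using inner_matrix_vector_commute[OF assms, of z t]
  by (simp add: matrix_vector_right_distrib inner_add_left inner_add_right
      matrix_vector_mult_scaleR power2_eq_square algebra_simps)

lemma inner_nonneg_orthant:
  fixes t v :: "real^'p"
  assumes "t \<in> nonneg_orthant" "v \<in> nonneg_orthant"
  shows "0 \<le> t \<bullet> v"
  using assms by (auto simp: nonneg_orthant_def inner_vec_def intro!: sum_nonneg)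

lemma inner_nonneg_orthant_eq_0D:
  fixes t v :: "real^'p"
  assumes "t \<in> nonneg_orthant" "v \<in> nonneg_orthant" "t \<bullet> v = 0" "t $ k \<noteq> 0"
  shows "v $ k = 0"
proof -
  have "t $ k * v $ k = 0"
    using assms sum_nonneg_eq_0_iff[of UNIV "\<lambda>i. t $ i * v $ i"]
    by (auto simp: nonneg_orthant_def inner_vec_def)
  with assms show ?thesis by simp
qed

lemma nonneg_orthant_scale_std_simplex:
  fixes t :: "real^'p"
  assumes "t \<in> nonneg_orthant" "t \<noteq> 0"
  obtains s u where "0 < s" "u \<in> std_simplex" "t = s *\<^sub>R u"
proof -
  define s where "s = (\<Sum>k\<in>UNIV. t $ k)"
  from assms(2) obtain k where "t $ k \<noteq> 0" by (auto simp: vec_eq_iff)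
  with assms(1) have "0 < s"
    unfolding s_def by (intro sum_pos2[of UNIV k]) (auto simp: nonneg_orthant_def less_le)
  moreover from this have "(1 / s) *\<^sub>R t \<in> std_simplex"
    using assms by (auto simp: std_simplex_def nonneg_orthant_def s_def
        simp flip: sum_divide_distrib)
  ultimately show ?thesis
    using that[of s "(1 / s) *\<^sub>R t"] by simp
qed

lemma compact_std_simplex: "compact (std_simplex :: (real^'p) set)"
proof (rule compact_eq_bounded_closed[THEN iffD2, OF conjI])
  have "(std_simplex :: (real^'p) set) \<subseteq> cbox 0 1"
  proof
    fix t :: "real^'p" assume t: "t \<in> std_simplex"
    have "t $ k \<le> 1" for k
      using t member_le_sum[of k UNIV "\<lambda>k. t $ k"]
      by (auto simp: std_simplex_def nonneg_orthant_def)
    with t show "t \<in> cbox 0 1"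
      by (auto simp: mem_box_cart std_simplex_def nonneg_orthant_def)
  qed
  then show "bounded (std_simplex :: (real^'p) set)"
    using bounded_cbox bounded_subset by blast
  have "std_simplex = (\<Inter>k. {t. 0 \<le> t $ k}) \<inter> {t :: real^'p. (\<Sum>k\<in>UNIV. t $ k) = 1}"
    by (auto simp: std_simplex_def nonneg_orthant_def)
  also have "closed \<dots>"
    by (intro closed_Int closed_INT ballI closed_Collect_le closed_Collect_eq continuous_intros)
  finally show "closed (std_simplex :: (real^'p) set)" .
qed

lemma continuous_on_quadratic_form:
  fixes D :: "real^'p^'p"
  shows "continuous_on S (\<lambda>t. t \<bullet> (D *v t))"
  by (intro continuous_intros)

lemma copositive_add: "C \<in> copositive \<Longrightarrow> D \<in> copositive \<Longrightarrow> C + D \<in> copositive"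
  by (simp add: copositive_def symmetric_matrix_def transpose_def vec_eq_iff
      matrix_vector_mult_add_rdistrib inner_add_right)

lemma copositive_scaleR: "D \<in> copositive \<Longrightarrow> 0 \<le> c \<Longrightarrow> c *\<^sub>R D \<in> copositive"
  by (simp add: copositive_def symmetric_matrix_def transpose_def vec_eq_iff
      scaleR_matrix_vector_assoc[symmetric])

text \<open>A zero of the form minimises it over the orthant, and the gradient there is twice this
vector; so the claim is the first-order optimality condition.\<close>

lemma copositive_zero_gradient_nonneg:
  fixes D :: "real^'p^'p"
  assumes "D \<in> copositive" "t \<in> nonneg_orthant" "t \<bullet> (D *v t) = 0"
  shows "D *v t \<in> nonneg_orthant"
proof -
  have sym: "symmetric_matrix D"
    using assms(1) by (simp add: copositive_def)
  have "0 \<le> (D *v t) $ k" for k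
  proof (rule ccontr)
    define g where "g = (D *v t) $ k"
    define d where "d = \<bar>axis k 1 \<bullet> (D *v axis k 1)\<bar> + 1"
    assume "\<not> 0 \<le> (D *v t) $ k"
    then have g: "g < 0" by (simp add: g_def)
    have d: "0 < d" by (simp add: d_def)
    \<comment> \<open>The form at \<open>t + s *\<^sub>R axis k 1\<close> is at most \<open>2 * s * g + s\<^sup>2 * d\<close>; this \<open>s\<close> minimises the bound.\<close>
    define s where "s = - g / d"
    have s: "0 < s" using g d by (simp add: s_def divide_neg_pos)
    have "t + s *\<^sub>R axis k 1 \<in> nonneg_orthant"
      using assms(2) s by (auto simp: nonneg_orthant_def axis_def)
    then have "0 \<le> (t + s *\<^sub>R axis k 1) \<bullet> (D *v (t + s *\<^sub>R axis k 1))"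
      using assms(1) by (auto simp: copositive_def)
    also have "\<dots> = 2 * s * g + s\<^sup>2 * (axis k 1 \<bullet> (D *v axis k 1))"
      using inner_matrix_vector_commute[OF sym, of t "axis k 1"]
      by (simp add: quadratic_form_add_scaleR[OF sym] assms(3) g_def inner_axis')
    also have "\<dots> \<le> 2 * s * g + s\<^sup>2 * d"
      by (intro add_left_mono mult_left_mono) (auto simp: d_def)
    also have "\<dots> = s * g"
      using d by (simp add: s_def power2_eq_square field_simps)
    also have "\<dots> < 0" using s g by (rule mult_pos_neg)
    finally show False by simp
  qed
  then show ?thesis by (simp add: nonneg_orthant_def)
qed

section \<open>Feasible directions of the copositive cone\<close>

text \<open>A positive minimum over the compact set absorbs every small multiple of the bounded function \<open>g\<close>.\<close>

lemma eventually_nonneg_on_compact: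
  fixes f g :: "'a::topological_space \<Rightarrow> real"
  assumes "compact K" "continuous_on K f" "continuous_on K g" "\<And>t. t \<in> K \<Longrightarrow> 0 < f t"
  shows "\<forall>\<^sub>F e in at_right 0. \<forall>t\<in>K. 0 \<le> f t + e * g t"
proof (cases "K = {}")
  case False
  obtain p where p: "p \<in> K" "\<And>t. t \<in> K \<Longrightarrow> f p \<le> f t"
    using continuous_attains_inf[OF assms(1) False assms(2)] by blast
  obtain q where q: "\<And>t. t \<in> K \<Longrightarrow> g q \<le> g t"
    using continuous_attains_inf[OF assms(1) False assms(3)] by blast
  have "((\<lambda>e. f p + e * g q) \<longlongrightarrow> f p + 0 * g q) (at_right 0)"
    by (intro tendsto_intros)
  with assms(4)[OF p(1)] have "\<forall>\<^sub>F e in at_right 0. 0 < f p + e * g q"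
    by (intro order_tendstoD) auto
  moreover have "\<forall>\<^sub>F e::real in at_right 0. 0 < e"
    by (rule eventually_at_right_less)
  ultimately show ?thesis
  proof eventually_elim
    case (elim e)
    show ?case
    proof
      fix t assume t: "t \<in> K"
      have "e * g q \<le> e * g t" using elim(2) q[OF t] by simp
      with p(2)[OF t] elim(1) show "0 \<le> f t + e * g t" by linarith
    qed
  qed
qed simp

text \<open>Subtracting from \<open>t\<close> the largest multiple of \<open>z\<close> that leaves it non-negative makes one
further entry vanish. This is the reduction step for the induction over faces.\<close>

lemma nonneg_orthant_reduce_support:
  fixes t z :: "real^'p"
  assumes "t \<in> nonneg_orthant" "z \<in> nonneg_orthant" "z \<noteq> 0"
  obtains s k where "0 \<le> s" "0 < z $ k" "t - s *\<^sub>R z \<in> nonneg_orthant" "(t - s *\<^sub>R z) $ k = 0"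
proof -
  define P where "P = {k. 0 < z $ k}"
  have "P \<noteq> {}"
    using assms(2,3) by (auto simp: P_def nonneg_orthant_def vec_eq_iff less_le)
  then obtain k where k: "k \<in> P" and min: "\<And>i. i \<in> P \<Longrightarrow> t $ k / z $ k \<le> t $ i / z $ i"
    using arg_min_if_finite(1)[of P "\<lambda>k. t $ k / z $ k"]
      arg_min_least[of P _ "\<lambda>k. t $ k / z $ k"] by auto
  define s where "s = t $ k / z $ k"
  have "0 \<le> (t - s *\<^sub>R z) $ i" for i
  proof (cases "i \<in> P")
    case True
    with min[OF True] show ?thesis by (simp add: s_def P_def pos_le_divide_eq)
  next
    case False
    with assms(1,2) have "z $ i = 0" "0 \<le> t $ i"
      by (auto simp: P_def nonneg_orthant_def less_le)
    then show ?thesis by simp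
  qed
  then show ?thesis
    using assms(1) k by (intro that[of s k]) (auto simp: s_def P_def nonneg_orthant_def)
qed

text \<open>The induction is over the set \<open>S\<close> of coordinates that may be non-zero. If \<open>D\<close> has no zero
supported in \<open>S\<close>, its form is bounded away from \<open>0\<close> on this face of the simplex. If it has a zero
\<open>z\<close>, then \<open>(D + e *\<^sub>R Y) *v z\<close> is non-negative for small \<open>e\<close>, since each entry of \<open>D *v z\<close> is either
positive or accompanied by a non-negative entry of \<open>Y *v z\<close>. So the form at \<open>t\<close> is at least the
form at the vector of smaller support that remains when a multiple of \<open>z\<close> is subtracted. Only one zero is chosen for each
of the finitely many faces, which is why a single bound on \<open>e\<close> suffices although the zero set may be
infinite.\<close>

lemma eventually_quadratic_form_nonneg_on_face:
  fixes D Y :: "real^'p^'p"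
  assumes D: "D \<in> copositive" and Y: "symmetric_matrix Y"
    and dir: "\<And>z k. \<lbrakk>z \<in> std_simplex; z \<bullet> (D *v z) = 0; (D *v z) $ k = 0\<rbrakk> \<Longrightarrow> 0 \<le> (Y *v z) $ k"
  shows "\<forall>\<^sub>F e in at_right 0. \<forall>t\<in>nonneg_orthant. (\<forall>k. k \<notin> S \<longrightarrow> t $ k = 0) \<longrightarrow>
           0 \<le> t \<bullet> ((D + e *\<^sub>R Y) *v t)"
proof (induction S rule: finite_psubset_induct[OF finite])
  case (1 S)
  define K where "K = std_simplex \<inter> {t. \<forall>k. k \<notin> S \<longrightarrow> t $ k = 0}"
  have form: "t \<bullet> ((D + e *\<^sub>R Y) *v t) = t \<bullet> (D *v t) + e * (t \<bullet> (Y *v t))" for t e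
    by (simp add: matrix_vector_mult_add_rdistrib scaleR_matrix_vector_assoc[symmetric] inner_add_right)
  have pos_form: "0 \<le> t \<bullet> (D *v t)" if "t \<in> nonneg_orthant" for t
    using D that by (simp add: copositive_def)
  show ?case
  proof (cases "\<exists>z\<in>K. z \<bullet> (D *v z) = 0")
    case False
    have "K = std_simplex \<inter> (\<Inter>k\<in>-S. {t. t $ k = 0})"
      by (auto simp: K_def)
    moreover have "closed (\<Inter>k\<in>-S. {t :: real^'p. t $ k = 0})"
      by (intro closed_INT ballI closed_Collect_eq continuous_intros)
    ultimately have "compact K"
      by (simp only: compact_Int_closed[OF compact_std_simplex])
    moreover have "0 < t \<bullet> (D *v t)" if "t \<in> K" for t
      using False pos_form[of t] that by (auto simp: K_def std_simplex_def less_le)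
    ultimately have "\<forall>\<^sub>F e in at_right 0. \<forall>t\<in>K. 0 \<le> t \<bullet> (D *v t) + e * (t \<bullet> (Y *v t))"
      by (intro eventually_nonneg_on_compact continuous_on_quadratic_form)
    then show ?thesis
    proof eventually_elim
      case (elim e)
      show ?case
      proof (intro ballI impI)
        fix t :: "real^'p"
        assume t: "t \<in> nonneg_orthant" and supp: "\<forall>k. k \<notin> S \<longrightarrow> t $ k = 0"
        show "0 \<le> t \<bullet> ((D + e *\<^sub>R Y) *v t)"
        proof (cases "t = 0")
          case False
          then obtain s u where s: "0 < s" "u \<in> std_simplex" "t = s *\<^sub>R u"
            using nonneg_orthant_scale_std_simplex[OF t] by blast
          with supp have "u \<in> K" by (auto simp: K_def)
          with elim have "0 \<le> u \<bullet> ((D + e *\<^sub>R Y) *v u)" by (simp add: form)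
          with s show ?thesis by (simp add: matrix_vector_mult_scaleR)
        qed simp
      qed
    qed
  next
    case True
    then obtain z where z: "z \<in> std_simplex" "z \<bullet> (D *v z) = 0"
      and z_supp: "\<And>k. k \<notin> S \<Longrightarrow> z $ k = 0"
      by (auto simp: K_def)
    have z_pos: "z \<in> nonneg_orthant" and z_nz: "z \<noteq> 0"
      using z(1) by (auto simp: std_simplex_def)
    have Dz: "0 \<le> (D *v z) $ k" for k
      using copositive_zero_gradient_nonneg[OF D z_pos z(2)] by (simp add: nonneg_orthant_def)
    have "\<forall>\<^sub>F e in at_right 0. 0 \<le> (D *v z) $ k + e * (Y *v z) $ k" for k
    proof (cases "(D *v z) $ k = 0")
      case True
      with dir[OF z True] show ?thesis
        by (auto intro: eventually_mono[OF eventually_at_right_less[of 0]])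
    next
      case False
      with Dz[of k] eventually_nonneg_on_compact[of "{0::real}" "\<lambda>_. (D *v z) $ k" "\<lambda>_. (Y *v z) $ k"]
      show ?thesis by simp
    qed
    then have grad: "\<forall>\<^sub>F e in at_right 0. \<forall>k. 0 \<le> (D *v z) $ k + e * (Y *v z) $ k"
      by (simp add: eventually_all_finite)
    have "\<forall>\<^sub>F e in at_right 0. \<forall>j\<in>S. \<forall>t\<in>nonneg_orthant. (\<forall>k. k \<notin> S - {j} \<longrightarrow> t $ k = 0) \<longrightarrow>
            0 \<le> t \<bullet> ((D + e *\<^sub>R Y) *v t)"
    proof (rule eventually_ball_finite[OF finite], rule ballI)
      fix j assume "j \<in> S"
      then show "\<forall>\<^sub>F e in at_right 0. \<forall>t\<in>nonneg_orthant. (\<forall>k. k \<notin> S - {j} \<longrightarrow> t $ k = 0) \<longrightarrow>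
          0 \<le> t \<bullet> ((D + e *\<^sub>R Y) *v t)"
        by (intro "1.IH") auto
    qed
    with grad show ?thesis
    proof eventually_elim
      case (elim e)
      let ?E = "D + e *\<^sub>R Y"
      have E_sym: "symmetric_matrix ?E"
        using D Y by (simp add: copositive_def symmetric_matrix_def transpose_def vec_eq_iff)
      have Ez: "?E *v z \<in> nonneg_orthant"
        using elim(1) by (simp add: nonneg_orthant_def matrix_vector_mult_add_rdistrib
            scaleR_matrix_vector_assoc[symmetric])
      show ?case
      proof (intro ballI impI)
        fix t :: "real^'p"
        assume t: "t \<in> nonneg_orthant" and supp: "\<forall>k. k \<notin> S \<longrightarrow> t $ k = 0"
        obtain s j where s: "0 \<le> s" "0 < z $ j" and w: "t - s *\<^sub>R z \<in> nonneg_orthant"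
          and wj: "(t - s *\<^sub>R z) $ j = 0"
          using nonneg_orthant_reduce_support[OF t z_pos z_nz] by blast
        define w where "w = t - s *\<^sub>R z"
        have "j \<in> S" using s(2) z_supp by force
        moreover have "w $ k = 0" if "k \<notin> S - {j}" for k
          using that supp z_supp wj by (cases "k = j") (auto simp: w_def)
        ultimately have "0 \<le> w \<bullet> (?E *v w)"
          using elim(2) w by (auto simp: w_def)
        moreover have "0 \<le> w \<bullet> (?E *v z)" "0 \<le> z \<bullet> (?E *v z)"
          using inner_nonneg_orthant[OF _ Ez] w z_pos by (auto simp: w_def)
        moreover have "t \<bullet> (?E *v t)
            = w \<bullet> (?E *v w) + 2 * s * (w \<bullet> (?E *v z)) + s\<^sup>2 * (z \<bullet> (?E *v z))"
          using quadratic_form_add_scaleR[OF E_sym, of w s z] by (simp add: w_def)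
        ultimately show "0 \<le> t \<bullet> (?E *v t)"
          using s(1) by simp
      qed
    qed
  qed
qed

corollary eventually_copositive_in_direction:
  fixes D Y :: "real^'p^'p"
  assumes D: "D \<in> copositive" and Y: "symmetric_matrix Y"
    and dir: "\<And>z k. \<lbrakk>z \<in> std_simplex; z \<bullet> (D *v z) = 0; (D *v z) $ k = 0\<rbrakk> \<Longrightarrow> 0 \<le> (Y *v z) $ k"
  shows "\<forall>\<^sub>F e in at_right 0. D + e *\<^sub>R Y \<in> copositive"
proof -
  have "\<forall>\<^sub>F e in at_right 0. \<forall>t\<in>nonneg_orthant. (\<forall>k. k \<notin> UNIV \<longrightarrow> t $ k = 0) \<longrightarrow>
          0 \<le> t \<bullet> ((D + e *\<^sub>R Y) *v t)"
    by (intro eventually_quadratic_form_nonneg_on_face assms)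
  then show ?thesis
  proof eventually_elim
    case (elim e)
    with D Y show ?case
      by (simp add: copositive_def symmetric_matrix_def transpose_def vec_eq_iff)
  qed
qed

section \<open>The homogenised matrix pencil\<close>

text \<open>The linear extension of the affine map \<open>mat_fun\<close> to the space that contains the vectors
\<open>a_vec\<close> and \<open>b_vec\<close>: pairing those vectors with \<open>w\<close> evaluates the matrix belonging to \<open>w\<close>.\<close>

definition pencil :: "real^'p^'p \<Rightarrow> ('n::finite \<Rightarrow> real^'p^'p) \<Rightarrow> real \<times> (real^'n) \<Rightarrow> real^'p^'p" where
  "pencil A0 A w = fst w *\<^sub>R A0 + (\<Sum>m\<in>UNIV. snd w $ m *\<^sub>R A m)"

lemma mat_fun_eq_pencil: "mat_fun A0 A x = pencil A0 A (1, x)"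
  by (simp add: mat_fun_def pencil_def)

lemma pencil_add: "pencil A0 A (v + w) = pencil A0 A v + pencil A0 A w"
  by (simp add: pencil_def scaleR_add_left sum.distrib)

lemma pencil_scaleR: "pencil A0 A (c *\<^sub>R w) = c *\<^sub>R pencil A0 A w"
  by (simp add: pencil_def scaleR_add_right scaleR_right.sum)

lemma symmetric_pencil:
  assumes "symmetric_matrix A0" "\<And>m. symmetric_matrix (A m)"
  shows "symmetric_matrix (pencil A0 A w)"
  using assms by (simp add: symmetric_matrix_def pencil_def transpose_def vec_eq_iff)

lemma inner_pencil_mult:
  "u \<bullet> (pencil A0 A w *v t) = w \<bullet> (u \<bullet> (A0 *v t), \<chi> m. u \<bullet> (A m *v t))"
proof -
  have "(\<Sum>m\<in>F. snd w $ m *\<^sub>R A m) *v t = (\<Sum>m\<in>F. snd w $ m *\<^sub>R (A m *v t))"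
    if "finite F" for F
    using that by induction
      (simp_all add: matrix_vector_mult_add_rdistrib scaleR_matrix_vector_assoc[symmetric])
  then show ?thesis
    by (simp add: pencil_def inner_prod_def inner_vec_def[of "snd w"] inner_add_right inner_sum_right
        matrix_vector_mult_add_rdistrib scaleR_matrix_vector_assoc[symmetric])
qed

lemma inner_a_vec: "w \<bullet> a_vec A0 A t = t \<bullet> (pencil A0 A w *v t)"
  by (simp add: a_vec_def inner_pencil_mult)

lemma inner_b_vec: "w \<bullet> b_vec A0 A k t = (pencil A0 A w *v t) $ k"
  using inner_pencil_mult[of "axis k 1" A0 A w t] by (simp add: b_vec_def inner_axis')

lemma b_vec_sum_scaleR: "b_vec A0 A k (\<Sum>v\<in>F. u v *\<^sub>R v) = (\<Sum>v\<in>F. u v *\<^sub>R b_vec A0 A k v)"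
  by (rule vector_eq_rdot[THEN iffD1], rule allI, subst (1 2) inner_commute)
     (simp add: inner_b_vec inner_sum_left inner_sum_right linear_sum[OF matrix_vector_mul_linear]
       matrix_vector_mult_scaleR)

lemma a_vec_eq_sum_b_vec: "a_vec A0 A t = (\<Sum>k\<in>UNIV. t $ k *\<^sub>R b_vec A0 A k t)"
  by (rule vector_eq_ldot[THEN iffD1])
     (simp add: inner_a_vec inner_b_vec inner_sum_right inner_vec_def[of t])

lemma zero_indices_iff:
  "k \<in> zero_indices A0 A t \<longleftrightarrow> (\<forall>x\<in>feasible A0 A. (mat_fun A0 A x *v t) $ k = 0)"
  by (simp add: zero_indices_def inner_axis')

section \<open>Immobile indices\<close>

lemma immobile_gradient_nonneg:
  assumes "t \<in> immobile A0 A" "x \<in> feasible A0 A"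
  shows "mat_fun A0 A x *v t \<in> nonneg_orthant"
  using assms by (intro copositive_zero_gradient_nonneg)
    (auto simp: immobile_def feasible_def std_simplex_def)

lemma support_subset_zero_indices:
  assumes t: "t \<in> immobile A0 A" and "t $ k \<noteq> 0"
  shows "k \<in> zero_indices A0 A t"
  unfolding zero_indices_iff
proof
  fix x assume x: "x \<in> feasible A0 A"
  show "(mat_fun A0 A x *v t) $ k = 0"
    using t x assms(2) immobile_gradient_nonneg[OF t x]
    by (intro inner_nonneg_orthant_eq_0D[of t]) (auto simp: immobile_def std_simplex_def)
qed

lemma compact_immobile: "compact (immobile A0 A)"
proof -
  have "immobile A0 A
      = std_simplex \<inter> (\<Inter>x\<in>feasible A0 A. {t. t \<bullet> (mat_fun A0 A x *v t) = 0})"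
    by (auto simp: immobile_def)
  moreover have "closed (\<Inter>x\<in>feasible A0 A. {t. t \<bullet> (mat_fun A0 A x *v t) = 0})"
    by (intro closed_INT ballI closed_Collect_eq continuous_on_quadratic_form continuous_on_const)
  ultimately show ?thesis
    by (simp only: compact_Int_closed[OF compact_std_simplex])
qed

lemma immobile_subset_convex_hull_vertices:
  "immobile A0 A \<subseteq> convex hull immobile_vertices A0 A"
proof -
  have "convex hull immobile A0 A = convex hull immobile_vertices A0 A"
    unfolding immobile_vertices_def
    by (intro Krein_Milman_Minkowski compact_convex_hull compact_immobile convex_convex_hull)
  then show ?thesis
    using hull_subset[of "immobile A0 A" convex] by simp
qed

lemma immobile_vertices_subset: "immobile_vertices A0 A \<subseteq> immobile A0 A"
  by (auto simp: immobile_vertices_def extreme_point_of_convex_hull)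

text \<open>Write \<open>t\<close> as a convex combination of vertices. For every feasible \<open>x\<close> the entry of
\<open>mat_fun A0 A x *v t\<close> at \<open>k\<close> is the corresponding combination of the entries at the vertices. These
are non-negative, so they vanish together with the combination, and \<open>k\<close> is a zero index of every vertex
that occurs.\<close>

lemma b_vec_in_fin_cone_b_set:
  assumes t: "t \<in> immobile A0 A" and k: "k \<in> zero_indices A0 A t"
  shows "b_vec A0 A k t \<in> fin_cone (b_set A0 A)"
proof -
  have "t \<in> convex hull immobile_vertices A0 A"
    using t immobile_subset_convex_hull_vertices by blast
  then obtain F u where F: "finite F" "F \<subseteq> immobile_vertices A0 A" and u: "\<forall>v\<in>F. 0 \<le> u v"
    and t_eq: "t = (\<Sum>v\<in>F. u v *\<^sub>R v)"
    unfolding convex_hull_explicit by blast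
  have summand: "u v *\<^sub>R b_vec A0 A k v \<in> convex_cone hull (b_set A0 A)" if v: "v \<in> F" for v
  proof (cases "u v = 0")
    case True
    then show ?thesis by (simp add: convex_cone_hull_contains_0)
  next
    case False
    have "k \<in> zero_indices A0 A v"
      unfolding zero_indices_iff
    proof
      fix x assume x: "x \<in> feasible A0 A"
      have "(\<Sum>v\<in>F. u v * (mat_fun A0 A x *v v) $ k) = (mat_fun A0 A x *v t) $ k"
        by (simp add: t_eq linear_sum[OF matrix_vector_mul_linear] matrix_vector_mult_scaleR)
      also have "\<dots> = 0"
        using k x by (simp add: zero_indices_iff)
      finally have sum0: "(\<Sum>v\<in>F. u v * (mat_fun A0 A x *v v) $ k) = 0" .
      have "0 \<le> u v * (mat_fun A0 A x *v v) $ k" if "v \<in> F" for v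
      proof -
        have "v \<in> immobile A0 A"
          using that F(2) immobile_vertices_subset by blast
        then show ?thesis
          using immobile_gradient_nonneg[OF _ x, of v] u that by (simp add: nonneg_orthant_def)
      qed
      with sum0 F(1) have "\<forall>v\<in>F. u v * (mat_fun A0 A x *v v) $ k = 0"
        by (simp add: sum_nonneg_eq_0_iff)
      with v False show "(mat_fun A0 A x *v v) $ k = 0" by auto
    qed
    with v F(2) have "b_vec A0 A k v \<in> b_set A0 A"
      by (auto simp: b_set_def)
    with u v show ?thesis
      by (intro convex_cone_hull_mul hull_inc) auto
  qed
  have "(\<Sum>v\<in>F. u v *\<^sub>R b_vec A0 A k v) \<in> convex_cone hull (b_set A0 A)"
    using F(1) summand
    by (induction F) (auto simp: convex_cone_hull_contains_0 intro!: convex_cone_hull_add)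
  then show ?thesis
    by (simp add: t_eq b_vec_sum_scaleR fin_cone_eq_convex_cone_hull)
qed

lemma fin_cone_minimal: "B \<subseteq> fin_cone C \<Longrightarrow> fin_cone B \<subseteq> fin_cone C"
  by (simp add: fin_cone_eq_convex_cone_hull hull_minimal convex_cone_convex_cone_hull)

lemma fin_cone_a_set_subset: "fin_cone (a_set A0 A) \<subseteq> fin_cone (b_set A0 A)"
proof (rule fin_cone_minimal, safe)
  fix v assume "v \<in> a_set A0 A"
  then obtain t where t: "t \<in> immobile A0 A" and v: "v = a_vec A0 A t"
    by (auto simp: a_set_def)
  have summand: "t $ k *\<^sub>R b_vec A0 A k t \<in> convex_cone hull (b_set A0 A)" for k
  proof (cases "t $ k = 0")
    case True
    then show ?thesis by (simp add: convex_cone_hull_contains_0)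
  next
    case False
    then have "b_vec A0 A k t \<in> convex_cone hull (b_set A0 A)"
      using b_vec_in_fin_cone_b_set[OF t support_subset_zero_indices[OF t]]
      by (simp add: fin_cone_eq_convex_cone_hull)
    moreover have "0 \<le> t $ k"
      using t by (simp add: immobile_def std_simplex_def nonneg_orthant_def)
    ultimately show ?thesis
      by (rule convex_cone_hull_mul)
  qed
  have "(\<Sum>k\<in>F. t $ k *\<^sub>R b_vec A0 A k t) \<in> convex_cone hull (b_set A0 A)" if "finite F" for F
    using that summand by induction (auto simp: convex_cone_hull_contains_0 intro!: convex_cone_hull_add)
  then show "v \<in> fin_cone (b_set A0 A)"
    by (simp add: v a_vec_eq_sum_b_vec fin_cone_eq_convex_cone_hull)
qed

section \<open>Relative interior points of the feasible set\<close>

lemma convex_feasible: "convex (feasible A0 A)"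
proof (rule convexI)
  fix x y and u v :: real
  assume xy: "x \<in> feasible A0 A" "y \<in> feasible A0 A" and uv: "0 \<le> u" "0 \<le> v" "u + v = 1"
  have "(1 :: real, u *\<^sub>R x + v *\<^sub>R y) = u *\<^sub>R (1, x) + v *\<^sub>R (1, y)"
    using uv by simp
  then have "mat_fun A0 A (u *\<^sub>R x + v *\<^sub>R y) = u *\<^sub>R mat_fun A0 A x + v *\<^sub>R mat_fun A0 A y"
    by (simp only: mat_fun_eq_pencil pencil_add pencil_scaleR)
  with xy uv show "u *\<^sub>R x + v *\<^sub>R y \<in> feasible A0 A"
    by (simp add: feasible_def copositive_add copositive_scaleR)
qed

text \<open>Every segment of the set can be prolonged a little beyond a relative interior point; an affine
function that is positive at one end and zero at this point would be negative on the
prolongation.\<close>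

lemma affine_function_zero_at_rel_interior:
  fixes S :: "'a::euclidean_space set" and c :: real
  assumes "convex S" "z \<in> rel_interior S" "\<And>x. x \<in> S \<Longrightarrow> 0 \<le> c + w \<bullet> x" "c + w \<bullet> z = 0" "x \<in> S"
  shows "c + w \<bullet> x = 0"
proof -
  have "S \<noteq> {}" using assms(5) by blast
  then obtain e where e: "1 < e" "(1 - e) *\<^sub>R x + e *\<^sub>R z \<in> S"
    using convex_rel_interior_iff[OF assms(1), of z] assms(2,5) by blast
  have "0 \<le> c + w \<bullet> ((1 - e) *\<^sub>R x + e *\<^sub>R z)"
    using assms(3) e(2) by blast
  also have "\<dots> = (1 - e) * (c + w \<bullet> x) + e * (c + w \<bullet> z)"
    by (simp add: inner_add_right algebra_simps)
  finally have "c + w \<bullet> x \<le> 0"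
    using assms(4) e(1) by (simp add: zero_le_mult_iff)
  with assms(3)[OF assms(5)] show ?thesis by simp
qed

lemma inner_zero_on_feasible:
  fixes v :: "real \<times> (real^'n)"
  assumes "x0 \<in> rel_interior (feasible A0 A)" "\<And>x. x \<in> feasible A0 A \<Longrightarrow> 0 \<le> (1, x) \<bullet> v"
    and "(1, x0) \<bullet> v = 0" "x \<in> feasible A0 A"
  shows "(1, x) \<bullet> v = 0"
  using affine_function_zero_at_rel_interior[OF convex_feasible assms(1), of "fst v" "snd v" x]
    assms(2-4) by (simp add: inner_prod_def inner_commute)

lemma immobile_if_zero_at_rel_interior:
  assumes "x0 \<in> rel_interior (feasible A0 A)" "t \<in> std_simplex"
    and "t \<bullet> (mat_fun A0 A x0 *v t) = 0"
  shows "t \<in> immobile A0 A"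
  using assms inner_zero_on_feasible[OF assms(1), of "a_vec A0 A t"]
  by (auto simp: immobile_def inner_a_vec feasible_def copositive_def std_simplex_def
      simp flip: mat_fun_eq_pencil)

lemma zero_index_if_zero_at_rel_interior:
  assumes "x0 \<in> rel_interior (feasible A0 A)" "t \<in> immobile A0 A"
    and "(mat_fun A0 A x0 *v t) $ k = 0"
  shows "k \<in> zero_indices A0 A t"
  using assms inner_zero_on_feasible[OF assms(1), of "b_vec A0 A k t"]
    immobile_gradient_nonneg[OF assms(2)]
  by (auto simp: zero_indices_iff inner_b_vec nonneg_orthant_def simp flip: mat_fun_eq_pencil)

section \<open>The cone of the immobile indices as a subspace\<close>

text \<open>The proof moves the parameter from a relative interior point \<open>x0\<close> of the feasible set in the
direction \<open>y\<close>. There every zero of the form is immobile and every vanishing gradient entry belongs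
to a zero index, so the hypothesis on \<open>y\<close> is exactly what makes the perturbed matrix copositive.
Dividing by the first component of \<open>(1, x0) + e *\<^sub>R y\<close>, which is positive for small \<open>e\<close>, gives a
feasible point, and immobile forms vanish at it as they do at \<open>x0\<close>.\<close>

lemma inner_a_set_zero_if_inner_b_set_nonneg:
  fixes A0 :: "real^'p^'p" and A :: "'n::finite \<Rightarrow> real^'p^'p"
  assumes sym: "symmetric_matrix A0" "\<And>m. symmetric_matrix (A m)"
    and cons: "feasible A0 A \<noteq> {}"
    and y: "\<And>v. v \<in> fin_cone (b_set A0 A) \<Longrightarrow> 0 \<le> y \<bullet> v"
    and v: "v \<in> a_set A0 A"
  shows "y \<bullet> v = 0"
proof -
  obtain x0 where x0: "x0 \<in> rel_interior (feasible A0 A)"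
    using rel_interior_eq_empty[OF convex_feasible] cons by blast
  then have x0_feas: "x0 \<in> feasible A0 A"
    using rel_interior_subset by blast
  have "\<forall>\<^sub>F e in at_right 0. mat_fun A0 A x0 + e *\<^sub>R pencil A0 A y \<in> copositive"
  proof (rule eventually_copositive_in_direction)
    fix z k
    assume z: "z \<in> std_simplex" "z \<bullet> (mat_fun A0 A x0 *v z) = 0"
      and k: "(mat_fun A0 A x0 *v z) $ k = 0"
    have "z \<in> immobile A0 A"
      using immobile_if_zero_at_rel_interior[OF x0 z] .
    then have "b_vec A0 A k z \<in> fin_cone (b_set A0 A)"
      using b_vec_in_fin_cone_b_set zero_index_if_zero_at_rel_interior[OF x0 _ k] by blast
    from y[OF this] show "0 \<le> (pencil A0 A y *v z) $ k"
      by (simp only: inner_b_vec)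
  qed (use x0_feas symmetric_pencil[of A0 A] sym in \<open>auto simp: feasible_def\<close>)
  moreover have "\<forall>\<^sub>F e in at_right 0. 0 < 1 + e * fst y"
  proof -
    have "((\<lambda>e. 1 + e * fst y) \<longlongrightarrow> 1 + 0 * fst y) (at_right 0)"
      by (intro tendsto_intros)
    then show ?thesis by (intro order_tendstoD) auto
  qed
  moreover have "\<forall>\<^sub>F e::real in at_right 0. 0 < e"
    by (rule eventually_at_right_less)
  ultimately have "\<forall>\<^sub>F e in at_right 0. mat_fun A0 A x0 + e *\<^sub>R pencil A0 A y \<in> copositive
      \<and> 0 < 1 + e * fst y \<and> 0 < e"
    by eventually_elim simp
  then obtain e where e: "mat_fun A0 A x0 + e *\<^sub>R pencil A0 A y \<in> copositive"
    "0 < 1 + e * fst y" "0 < e"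
    using eventually_happens[of _ "at_right (0::real)"] by auto
  \<comment> \<open>The pencil is linear and feasibility is read off at first component \<open>1\<close>, hence the scaling.\<close>
  define r where "r = 1 / (1 + e * fst y)"
  define x where "x = r *\<^sub>R (x0 + e *\<^sub>R snd y)"
  have r: "0 < r" using e(2) by (simp add: r_def)
  have x: "(1, x) = r *\<^sub>R ((1, x0) + e *\<^sub>R y)"
    using e(2) by (cases y) (simp add: x_def r_def)
  have "mat_fun A0 A x = r *\<^sub>R (mat_fun A0 A x0 + e *\<^sub>R pencil A0 A y)"
    by (simp only: mat_fun_eq_pencil x pencil_add pencil_scaleR)
  with e(1) r have "mat_fun A0 A x \<in> copositive"
    by (simp add: copositive_scaleR)
  then have x_feas: "x \<in> feasible A0 A" by (simp add: feasible_def)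
  have zero: "(1, x') \<bullet> v = 0" if "x' \<in> feasible A0 A" for x'
    using v that by (auto simp: a_set_def inner_a_vec immobile_def simp flip: mat_fun_eq_pencil)
  have "r * ((1, x0) \<bullet> v + e * (y \<bullet> v)) = 0"
    using zero[OF x_feas] unfolding x inner_scaleR_left inner_add_left .
  with r e(3) zero[OF x0_feas] show ?thesis by simp
qed

text \<open>If \<open>0\<close> is not in the relative interior of the cone, then there is a supporting hyperplane at
\<open>0\<close> that does not contain the cone.\<close>

lemma convex_cone_eq_span:
  fixes C :: "'a::euclidean_space set"
  assumes C: "convex_cone C"
    and flat: "\<And>y. (\<And>v. v \<in> C \<Longrightarrow> 0 \<le> y \<bullet> v) \<Longrightarrow> \<forall>v\<in>C. y \<bullet> v = 0"
  shows "span C = C"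
proof
  show "C \<subseteq> span C" by (rule span_superset)
  have conv: "convex C" and zero: "0 \<in> C"
    and scale: "\<And>c v. v \<in> C \<Longrightarrow> 0 \<le> c \<Longrightarrow> c *\<^sub>R v \<in> C"
    using C convex_cone_contains_0[OF C] by (auto simp: convex_cone_def conic_def)
  have zero_ri: "0 \<in> rel_interior C"
  proof (rule ccontr)
    assume "0 \<notin> rel_interior C"
    then obtain y where y: "\<And>v. v \<in> C \<Longrightarrow> y \<bullet> 0 \<le> y \<bullet> v"
      and y_pos: "\<And>v. v \<in> rel_interior C \<Longrightarrow> y \<bullet> 0 < y \<bullet> v"
      using supporting_hyperplane_rel_boundary[OF conv zero] by metis
    obtain v where v: "v \<in> rel_interior C"
      using rel_interior_eq_empty[OF conv] zero by blast
    then have "v \<in> C" using rel_interior_subset by blast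
    moreover have "\<forall>v\<in>C. y \<bullet> v = 0"
      by (rule flat) (use y in simp)
    ultimately show False using y_pos[OF v] by simp
  qed
  have neg: "- v \<in> C" if v: "v \<in> C" for v
  proof -
    have "C \<noteq> {}" using zero by blast
    then obtain e where e: "1 < e" "(1 - e) *\<^sub>R v + e *\<^sub>R 0 \<in> C"
      using convex_rel_interior_iff[OF conv, of 0] zero_ri v by blast
    then have "(1 / (e - 1)) *\<^sub>R ((1 - e) *\<^sub>R v) \<in> C"
      using scale[of "(1 - e) *\<^sub>R v" "1 / (e - 1)"] by simp
    moreover have "(1 / (e - 1)) * (1 - e) = - 1"
      using e(1) by (simp add: field_simps)
    ultimately show ?thesis by simp
  qed
  have "subspace C"
  proof (rule subspaceI)
    fix c and v assume v: "v \<in> C"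
    show "c *\<^sub>R v \<in> C"
    proof (cases "0 \<le> c")
      case False
      with scale[OF neg[OF v], of "- c"] show ?thesis by simp
    qed (use scale v in blast)
  qed (use C zero in \<open>auto simp: convex_cone_iff\<close>)
  then show "span C \<subseteq> C"
    by (simp add: span_minimal)
qed

lemma fin_cone_subset_span: "fin_cone B \<subseteq> span B"
  unfolding fin_cone_def by (auto intro!: span_sum span_scale intro: span_base)

lemma fin_cone_superset: "B \<subseteq> fin_cone B"
  by (simp add: fin_cone_eq_convex_cone_hull hull_subset)

lemma span_b_set_eq_fin_cone:
  assumes "symmetric_matrix A0" "\<And>m. symmetric_matrix (A m)" "feasible A0 A \<noteq> {}"
    and eq: "fin_cone (b_set A0 A) = fin_cone (a_set A0 A)"
  shows "span (b_set A0 A) = fin_cone (a_set A0 A)"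
proof -
  let ?C = "fin_cone (b_set A0 A)"
  have "span ?C = ?C"
  proof (rule convex_cone_eq_span)
    show "convex_cone ?C"
      by (simp add: fin_cone_eq_convex_cone_hull convex_cone_convex_cone_hull)
    fix y assume y: "\<And>v. v \<in> ?C \<Longrightarrow> 0 \<le> y \<bullet> v"
    have "y \<bullet> v = 0" if "v \<in> a_set A0 A" for v
      using inner_a_set_zero_if_inner_b_set_nonneg[OF assms(1-3) y that] .
    then have "span (a_set A0 A) \<subseteq> {v. y \<bullet> v = 0}"
      by (intro span_minimal subspace_hyperplane) auto
    then show "\<forall>v\<in>?C. y \<bullet> v = 0"
      using fin_cone_subset_span[of "a_set A0 A"] eq by auto
  qed
  moreover have "span (b_set A0 A) = span ?C"
    using span_mono[OF fin_cone_superset] span_minimal[OF fin_cone_subset_span subspace_span]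
    by (rule subset_antisym)
  ultimately show ?thesis using eq by simp
qed

theorem proposition4:
  fixes A0 :: "real^'p^'p" and A :: "'n::finite \<Rightarrow> real^'p^'p"
  assumes "CARD('p) > 1"
    and "symmetric_matrix A0" and "\<And>m. symmetric_matrix (A m)"
    and "feasible A0 A \<noteq> {}"
  shows "((\<forall>\<tau>\<in>immobile_vertices A0 A. \<forall>k\<in>zero_indices A0 A \<tau>.
              b_vec A0 A k \<tau> \<in> fin_cone (a_set A0 A))
            \<longleftrightarrow> fin_cone (b_set A0 A) = fin_cone (a_set A0 A))
         \<and> (fin_cone (b_set A0 A) = fin_cone (a_set A0 A)
            \<longleftrightarrow> span (b_set A0 A) = fin_cone (a_set A0 A))"
proof (intro conjI)
  have "(\<forall>\<tau>\<in>immobile_vertices A0 A. \<forall>k\<in>zero_indices A0 A \<tau>.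
          b_vec A0 A k \<tau> \<in> fin_cone (a_set A0 A))
      \<longleftrightarrow> b_set A0 A \<subseteq> fin_cone (a_set A0 A)"
    by (auto simp: b_set_def)
  also have "\<dots> \<longleftrightarrow> fin_cone (b_set A0 A) = fin_cone (a_set A0 A)"
    using fin_cone_minimal fin_cone_superset fin_cone_a_set_subset by blast
  finally show "(\<forall>\<tau>\<in>immobile_vertices A0 A. \<forall>k\<in>zero_indices A0 A \<tau>.
          b_vec A0 A k \<tau> \<in> fin_cone (a_set A0 A))
      \<longleftrightarrow> fin_cone (b_set A0 A) = fin_cone (a_set A0 A)" .
  show "fin_cone (b_set A0 A) = fin_cone (a_set A0 A)
      \<longleftrightarrow> span (b_set A0 A) = fin_cone (a_set A0 A)"
    using span_b_set_eq_fin_cone[OF assms(2-4)] fin_cone_a_set_subset fin_cone_subset_span by blast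
qed

end
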